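(* For any fixed integer $r\ge 1$, $$\sum_{n\le x}\frac{\overline{c}_r(n)}{n}=\log x+C-(\Lambda\oplus 1)(r)+O(x^{-1}),$$ where $x\ge 1$ is real, $n$ runs through the integers from $1$ to $\lfloor x\rfloor$, $C$ is Euler's constant, and the implied constant may depend on $r$.
   Context: $\Lambda$ is the von Mangoldt function. An integer $a$ is regular (mod $r$) if there is an integer $y$ with $a^2y\equiv a \pmod r$. Define $$\overline{c}_r(n)=\sum_{\substack{a \pmod r\\ a\text{ regular}\pmod r}}\exp(2\pi i a n/r),$$ the sum being over the regular elements $a$ of a complete residue system mod $r$ (e.g. $1\le a\le r$). A positive divisor $d$ of $r$ is a unitary divisor, written $d\,\|\,r$, if $\gcd(d,r/d)=1$; the unitary convolution is $(f\oplus g)(r)=\sum_{d\,\|\,r}f(d)g(r/d)$, and $1$ denotes the constant function $1$. *)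

theory Defs
  imports "HOL-Analysis.Analysis" "HOL-Number_Theory.Number_Theory"
begin

definition regular_mod :: "nat \<Rightarrow> int \<Rightarrow> bool" where
  "regular_mod r a \<longleftrightarrow> (\<exists>y::int. [a\<^sup>2 * y = a] (mod int r))"

definition regular_ramanujan_sum :: "nat \<Rightarrow> nat \<Rightarrow> complex" where
  "regular_ramanujan_sum r n =
     (\<Sum>a\<in>{a\<in>{1..int r}. regular_mod r a}.
        exp (2 * of_real pi * \<i> * of_int a * of_nat n / of_nat r))"

definition unitary_divisor :: "nat \<Rightarrow> nat \<Rightarrow> bool" where
  "unitary_divisor d r \<longleftrightarrow> 0 < d \<and> d dvd r \<and> coprime d (r div d)"

definition unitary_conv ::
    "(nat \<Rightarrow> 'a::comm_semiring_1) \<Rightarrow> (nat \<Rightarrow> 'a) \<Rightarrow> nat \<Rightarrow> 'a" where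
  "unitary_conv f g r = (\<Sum>d\<in>{d. unitary_divisor d r}. f d * g (r div d))"

end

theory Submission
  imports Defs "HOL-Library.Landau_Symbols"
begin

text \<open>
  Grouping the regular residues \<open>a\<close> by the reduced denominator \<open>d\<close> of \<open>a/r\<close> expresses
  \<open>regular_ramanujan_sum r n\<close> as the sum of the classical Ramanujan sums \<open>c\<^sub>d(n)\<close> over the unitary divisors
  \<open>d\<close> of \<open>r\<close>. It therefore suffices to know \<open>F\<^sub>d(x) = \<Sum>n\<le>x. c\<^sub>d(n)/n\<close>. Since
  \<open>\<Sum>d|r. c\<^sub>d(n)\<close> is \<open>r\<close> if \<open>r\<close> divides \<open>n\<close> and \<open>0\<close> otherwise, \<open>\<Sum>d|r. F\<^sub>d(x)\<close> is the harmonic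
  number of \<open>x/r\<close>, i.e. \<open>ln x + C - ln r + O(1/x)\<close>. As \<open>ln r = \<Sum>d|r. \<Lambda>(d)\<close>, induction on the
  divisors gives \<open>F\<^sub>d(x) = -\<Lambda>(d) + O(1/x)\<close> for \<open>d > 1\<close>, while \<open>F\<^sub>1(x) = ln x + C + O(1/x)\<close>.
\<close>

section \<open>Ramanujan sums and divisor sums of exponentials\<close>

definition ramanujan_sum :: "nat \<Rightarrow> nat \<Rightarrow> complex" where
  "ramanujan_sum d n =
     (\<Sum>k\<in>totatives d. exp (2 * of_real pi * \<i> * of_nat k * of_nat n / of_nat d))"

text \<open>Writing \<open>a / r\<close> in lowest terms as \<open>k / d\<close> matches the
  residues \<open>a\<close> with pairs of a divisor \<open>d\<close> of \<open>r\<close> and a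
  totative \<open>k\<close> of \<open>d\<close>, and leaves the exponential unchanged. The predicate
  \<open>P\<close> on the denominator lets one statement serve both all residues and the regular
  ones.\<close>

lemma sum_exp_by_denominator:
  assumes "r > 0"
  shows "(\<Sum>a | a \<in> {0<..r} \<and> P (r div gcd a r).
            exp (2 * of_real pi * \<i> * of_nat a * of_nat n / of_nat r)) =
         (\<Sum>d | d dvd r \<and> P d. ramanujan_sum d n)"
proof -
  have fin: "finite {d. d dvd r \<and> P d}"
    using assms by (auto intro: finite_subset[OF _ finite_divisors_nat[of r]])
  have gcd_eq: "gcd (k * (r div d)) r = r div d" if "d dvd r" "coprime k d" for k d
  proof -
    obtain g where g: "r = d * g" using \<open>d dvd r\<close> by (elim dvdE)
    have "gcd (g * k) (g * d) = g * gcd k d" by (rule gcd_mult_distrib_nat [symmetric])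
    thus ?thesis using that assms by (simp add: g mult.commute)
  qed
  have bij: "(\<Sum>(d, k)\<in>(SIGMA d:{d. d dvd r \<and> P d}. totatives d).
                exp (2 * of_real pi * \<i> * of_nat k * of_nat n / of_nat d)) =
             (\<Sum>a | a \<in> {0<..r} \<and> P (r div gcd a r).
                exp (2 * of_real pi * \<i> * of_nat a * of_nat n / of_nat r))"
  \<comment> \<open>The range \<open>{0<..r}\<close> matters for \<open>d = 1\<close>: it contains
    \<open>a = r\<close>, which corresponds to \<open>k = 1\<close>, the only totative of 1.\<close>
  proof (rule sum.reindex_bij_witness
           [where i = "\<lambda>a. (r div gcd a r, a div gcd a r)" and j = "\<lambda>(d, k). k * (r div d)"])
    fix p assume "p \<in> (SIGMA d:{d. d dvd r \<and> P d}. totatives d)"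
    then obtain d k where p: "p = (d, k)" and d: "d dvd r" "P d"
      and k: "k > 0" "k \<le> d" "coprime k d"
      by (auto simp: in_totatives_iff)
    obtain g where g: "r = d * g" using d(1) by (elim dvdE)
    have pos: "d > 0" "g > 0" using g assms by auto
    note gk = gcd_eq[OF d(1) k(3)]
    show "(r div gcd (case p of (d, k) \<Rightarrow> k * (r div d)) r,
           (case p of (d, k) \<Rightarrow> k * (r div d)) div gcd (case p of (d, k) \<Rightarrow> k * (r div d)) r) = p"
      using gk pos by (simp add: p g)
    show "(case p of (d, k) \<Rightarrow> k * (r div d)) \<in> {a. a \<in> {0<..r} \<and> P (r div gcd a r)}"
      using gk pos k d by (simp add: p g)
    show "exp (2 * of_real pi * \<i> * of_nat (case p of (d, k) \<Rightarrow> k * (r div d)) * of_nat n / of_nat r) =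
          (case p of (d, k) \<Rightarrow> exp (2 * of_real pi * \<i> * of_nat k * of_nat n / of_nat d))"
      using pos by (simp add: p g mult_ac)
  next
    fix a assume a: "a \<in> {a. a \<in> {0<..r} \<and> P (r div gcd a r)}"
    have "coprime (a div gcd a r) (r div gcd a r)"
      using assms by (intro div_gcd_coprime) auto
    moreover have "r div gcd a r dvd r"
      by (metis dvd_div_mult_self dvd_triv_left gcd_dvd2)
    moreover have "a div gcd a r > 0"
      using a by (simp add: div_greater_zero_iff gcd_le1_nat)
    moreover have "a div gcd a r \<le> r div gcd a r"
      using a by (simp add: div_le_mono)
    ultimately show "(r div gcd a r, a div gcd a r) \<in> (SIGMA d:{d. d dvd r \<and> P d}. totatives d)"
      using a by (simp add: in_totatives_iff)
    show "(case (r div gcd a r, a div gcd a r) of (d, k) \<Rightarrow> k * (r div d)) = a"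
      using assms by (simp add: div_div_eq_right)
  qed
  show ?thesis
    unfolding ramanujan_sum_def bij [symmetric] using fin by (subst sum.Sigma) auto
qed

text \<open>A geometric sum over powers of an \<open>r\<close>-th root of unity \<open>w\<close>,
  which is 1 exactly when \<open>r\<close> divides \<open>n\<close>.\<close>

lemma sum_exp_multiples:
  assumes "r > 0"
  shows "(\<Sum>a\<in>{0<..r}. exp (2 * of_real pi * \<i> * of_nat a * of_nat n / of_nat r)) =
         (if r dvd n then of_nat r else 0 :: complex)"
proof -
  define w :: complex where "w = exp (2 * of_real pi * \<i> * of_nat n / of_nat r)"
  have pow: "exp (2 * of_real pi * \<i> * of_nat a * of_nat n / of_nat r) = w ^ a" for a
    unfolding w_def by (simp add: exp_of_nat_mult [symmetric] mult_ac)
  have "w = 1 \<longleftrightarrow> r dvd n"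
    using complex_root_unity_eq[of r n 0] assms by (simp add: w_def mod_eq_0_iff_dvd)
  moreover have "w ^ r = 1"
    using pow[of r] assms complex_root_unity_eq[of 1 n 0] by (simp add: mult_ac)
  moreover have "(\<Sum>a\<in>{0<..r}. w ^ a) = w * (\<Sum>a<r. w ^ a)"
    unfolding sum_distrib_left
    by (rule sum.reindex_bij_witness[where i = Suc and j = "\<lambda>a. a - 1"])
       (auto simp flip: power_Suc)
  ultimately show ?thesis
    unfolding pow by (auto simp: geometric_sum)
qed

lemma sum_ramanujan_sum_divisors:
  assumes "r > 0"
  shows "(\<Sum>d | d dvd r. ramanujan_sum d n) = (if r dvd n then of_nat r else 0)"
  using sum_exp_by_denominator[OF assms, where P = "\<lambda>_. True" and n = n] sum_exp_multiples[OF assms, of n]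
  by (simp add: greaterThanAtMost_def greaterThan_def atMost_def Int_def)

section \<open>Regular residues and unitary divisors\<close>

text \<open>
  With \<open>g = gcd a r\<close> and \<open>r = g d\<close>, dividing \<open>a\<^sup>2 y \<equiv> a\<close> by \<open>a\<close> shows that \<open>a\<close> is regular iff \<open>a\<close> is
  invertible modulo \<open>d\<close>; as \<open>a/g\<close> is coprime to \<open>d\<close>, this means that \<open>g\<close> is.
\<close>
lemma regular_mod_iff_unitary_divisor:
  assumes "r > 0" "a > 0"
  shows "regular_mod r (int a) \<longleftrightarrow> unitary_divisor (r div gcd a r) r"
proof -
  define g where "g = gcd a r"
  define b where "b = a div g"
  define d where "d = r div g"
  have ab: "a = g * b" and rd: "r = g * d" by (simp_all add: g_def b_def d_def)
  have g: "g > 0" and d: "d > 0" using assms by (auto simp: rd)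
  have bd: "coprime b d"
    unfolding b_def d_def g_def using assms by (intro div_gcd_coprime) auto
  have "regular_mod r (int a) \<longleftrightarrow> (\<exists>y. int d dvd int a * y - 1)"
  proof -
    have "[(int a)\<^sup>2 * y = int a] (mod int r) \<longleftrightarrow> int d dvd int a * y - 1" for y
    proof -
      have "(int a)\<^sup>2 * y - int a = int g * (int b * (int a * y - 1))"
        by (simp add: ab algebra_simps power2_eq_square)
      hence "[(int a)\<^sup>2 * y = int a] (mod int r) \<longleftrightarrow> int g * int d dvd int g * (int b * (int a * y - 1))"
        by (simp add: cong_iff_dvd_diff rd)
      also have "\<dots> \<longleftrightarrow> int d dvd int b * (int a * y - 1)" using g by simp
      also have "\<dots> \<longleftrightarrow> int d dvd int a * y - 1"
        using bd by (simp add: coprime_dvd_mult_right_iff coprime_commute)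
      finally show ?thesis .
    qed
    thus ?thesis by (simp add: regular_mod_def)
  qed
  also have "\<dots> \<longleftrightarrow> coprime (int a) (int d)"
    by (simp add: coprime_iff_invertible_int cong_iff_dvd_diff)
  also have "\<dots> \<longleftrightarrow> coprime g d" using bd by (simp add: ab)
  also have "\<dots> \<longleftrightarrow> unitary_divisor d r"
    using d g by (simp add: unitary_divisor_def rd coprime_commute)
  finally show ?thesis by (simp add: d_def g_def)
qed

text \<open>Regularity of \<open>a\<close> depends only on the reduced denominator of
  \<open>a / r\<close>, so the grouping applies with \<open>P\<close> as unitarity.\<close>

lemma regular_ramanujan_sum_conv_ramanujan_sum:
  assumes "r > 0"
  shows "regular_ramanujan_sum r n = (\<Sum>d | unitary_divisor d r. ramanujan_sum d n)"
proof -
  have "regular_ramanujan_sum r n =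
          (\<Sum>a | a \<in> {0<..r} \<and> unitary_divisor (r div gcd a r) r.
             exp (2 * of_real pi * \<i> * of_nat a * of_nat n / of_nat r))"
    unfolding regular_ramanujan_sum_def
    by (rule sum.reindex_bij_witness[where i = int and j = nat])
       (use assms regular_mod_iff_unitary_divisor[of r "nat a" for a] in auto)
  also have "\<dots> = (\<Sum>d | d dvd r \<and> unitary_divisor d r. ramanujan_sum d n)"
    by (rule sum_exp_by_denominator[OF assms])
  also have "{d. d dvd r \<and> unitary_divisor d r} = {d. unitary_divisor d r}"
    by (auto simp: unitary_divisor_def)
  finally show ?thesis .
qed

section \<open>Harmonic numbers at real arguments\<close>

text \<open>Two errors of at most \<open>1 / x\<close> add up: replacing
  \<open>harm n - ln (n + 1)\<close> by Euler's constant costs at most \<open>1 / (2 * n)\<close>,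
  and replacing \<open>ln (n + 1)\<close> by \<open>ln x\<close> costs at most
  \<open>1 / x\<close>.\<close>

lemma harm_floor_bound:
  assumes "x \<ge> (1::real)"
  shows "\<bar>harm (nat \<lfloor>x\<rfloor>) - (ln x + euler_mascheroni)\<bar> \<le> 2 / x"
proof -
  define n where "n = nat \<lfloor>x\<rfloor>"
  have n: "n \<ge> 1" "real n \<le> x" "x < real n + 1" using assms by (auto simp: n_def le_nat_iff le_floor_iff)
  have E: "euler_mascheroni \<ge> harm n - ln (real (Suc n)) + inverse (of_nat (2*(n+1)))"
          "euler_mascheroni \<le> harm n - ln (real (Suc n)) + inverse (of_nat (2*n))"
    using euler_mascheroni_bounds[OF n(1)] by auto
  have pos: "x > 0" "real n > 0" using n by auto
  have "inverse (of_nat (2*n)) \<le> 1 / x"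
  proof -
    have "x \<le> 2 * real n" using n by linarith
    thus ?thesis using pos by (simp add: field_simps)
  qed
  moreover have "inverse (of_nat (2*(n+1))) \<ge> (0::real)" by simp
  moreover have "ln (real (Suc n)) - ln x \<le> 1 / x"
  proof -
    have "ln (real (Suc n) / x) \<le> real (Suc n) / x - 1"
      by (rule ln_le_minus_one) (use pos in simp)
    also have "\<dots> = (real n + 1 - x) / x" using pos by (simp add: field_simps)
    also have "\<dots> \<le> 1 / x" using n pos by (intro divide_right_mono) auto
    finally show ?thesis using pos by (simp add: ln_div)
  qed
  moreover have "ln (real (Suc n)) - ln x \<ge> 0" using n pos by (simp add: ln_mono)
  moreover have "2 / x = 1 / x + 1 / x" by simp
  ultimately show ?thesis using E
    unfolding n_def [symmetric] by linarith
qed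

text \<open>With the filter \<open>principal {1..}\<close> the estimate is uniform in all
  \<open>x \<ge> 1\<close>, as the final bound demands, rather than only asymptotic. This forces the
  range \<open>x < r\<close> to be treated as well.\<close>

lemma harm_floor_divide_bigo:
  fixes r :: nat
  assumes "r > 0"
  shows "(\<lambda>x. complex_of_real (harm (nat \<lfloor>x / r\<rfloor>) - (ln x + euler_mascheroni - ln r)))
           \<in> O[principal {1..}](\<lambda>x. 1 / complex_of_real x)"
\<comment> \<open>For \<open>x \<ge> r\<close> the error is at most \<open>2 * r / x\<close>. For
  \<open>x < r\<close> the harmonic number is 0, the error is at most \<open>ln r + 1\<close>, and
  \<open>r / x\<close> exceeds 1. The constant covers both cases.\<close>
proof (rule bigoI[where c = "r * (ln r + 2)"], subst eventually_principal, rule ballI)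
  fix x :: real assume x: "x \<in> {1..}"
  hence ln: "ln x - ln r = ln (x / r)" using assms by (simp add: ln_div)
  have lnr: "ln (real r) \<ge> 0" using assms by (intro ln_ge_zero) simp
  have r: "real r > 0" using assms by simp
  have "\<bar>harm (nat \<lfloor>x / r\<rfloor>) - (ln (x / r) + euler_mascheroni)\<bar> \<le> (ln r + 2) * (r / x)"
  proof (cases "x \<ge> r")
    case True
    have "\<bar>harm (nat \<lfloor>x / r\<rfloor>) - (ln (x / r) + euler_mascheroni)\<bar> \<le> 2 * (r / x)"
      using harm_floor_bound[of "x / r"] True r by simp
    also have "\<dots> \<le> (ln r + 2) * (r / x)"
      using lnr x r by (intro mult_right_mono) auto
    finally show ?thesis .
  next
    case False
    hence "x / r < 1" using r by simp
    hence "nat \<lfloor>x / r\<rfloor> = 0" by (simp add: floor_le_iff)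
    moreover have "\<bar>ln (x / r) + euler_mascheroni\<bar> \<le> ln r + 1"
    proof -
      have "ln x \<ge> 0" "ln x \<le> ln r" using x False r by (auto intro: ln_mono)
      thus ?thesis using euler_mascheroni_pos euler_mascheroni_less_13_over_22
        unfolding ln [symmetric] by linarith
    qed
    moreover have "(ln r + 2) * 1 \<le> (ln r + 2) * (r / x)"
      using lnr False x by (intro mult_left_mono) auto
    ultimately show ?thesis by (simp add: harm_def)
  qed
  moreover have "(ln r + 2) * (r / x) = r * (ln r + 2) * norm (1 / complex_of_real x)" using x by (simp add: norm_divide)
  moreover have "harm (nat \<lfloor>x / r\<rfloor>) - (ln x + euler_mascheroni - ln r)
                   = harm (nat \<lfloor>x / r\<rfloor>) - (ln (x / r) + euler_mascheroni)"
    unfolding ln [symmetric] by simp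
  ultimately show "norm (complex_of_real (harm (nat \<lfloor>x / r\<rfloor>) - (ln x + euler_mascheroni - ln r)))
           \<le> r * (ln r + 2) * norm (1 / complex_of_real x)"
    unfolding norm_of_real by metis
qed

text \<open>Only \<open>n = m * r\<close> contributes, with term \<open>1 / m\<close>, and dividing
  by \<open>r\<close> commutes with taking floors.\<close>

lemma sum_multiples_harm:
  fixes r :: nat and x :: real
  assumes "r > 0" "x \<ge> 0"
  shows "(\<Sum>n\<in>{1..nat \<lfloor>x\<rfloor>}. (if r dvd n then of_nat r else 0) / of_nat n) =
         complex_of_real (harm (nat \<lfloor>x / r\<rfloor>))"
proof -
  have "nat \<lfloor>x / r\<rfloor> = nat \<lfloor>x\<rfloor> div r"
    using assms floor_divide_real_eq_div[of "int r" x] by (simp add: nat_div_distrib)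
  moreover have "(\<Sum>n\<in>{1..nat \<lfloor>x\<rfloor>}. (if r dvd n then of_nat r else 0) / of_nat n) =
                 (\<Sum>m\<in>{1..nat \<lfloor>x\<rfloor> div r}. inverse (of_nat m) :: complex)"
  proof -
    have "(\<Sum>n\<in>{1..nat \<lfloor>x\<rfloor>}. (if r dvd n then of_nat r else 0) / of_nat n) =
          (\<Sum>n | n \<in> {1..nat \<lfloor>x\<rfloor>} \<and> r dvd n. of_nat r / of_nat n :: complex)"
      by (intro sum.mono_neutral_cong_right) auto
    also have "\<dots> = (\<Sum>m\<in>{1..nat \<lfloor>x\<rfloor> div r}. inverse (of_nat m))"
      by (rule sum.reindex_bij_witness[where i = "\<lambda>m. m * r" and j = "\<lambda>n. n div r"])
         (use assms in \<open>auto simp: less_eq_div_iff_mult_less_eq div_le_mono field_simps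
                             dvd_imp_le Suc_le_eq div_greater_zero_iff\<close>)
    finally show ?thesis .
  qed
  ultimately show ?thesis by (simp add: harm_def)
qed

section \<open>Asymptotics of the partial sums\<close>

lemma ramanujan_sum_partial_sums:
  assumes "r > 0"
  shows "(\<lambda>x::real. (\<Sum>n\<in>{1..nat \<lfloor>x\<rfloor>}. ramanujan_sum r n / of_nat n) -
             of_real ((if r = 1 then ln x + euler_mascheroni else 0) - mangoldt r))
           \<in> O[principal {1..}](\<lambda>x. 1 / complex_of_real x)"
  using assms
proof (induction r rule: less_induct)
  case (less r)
  define F where "F = (\<lambda>d x. \<Sum>n\<in>{1..nat \<lfloor>x::real\<rfloor>}. ramanujan_sum d n / of_nat n)"
  define M where "M = (\<lambda>d (x::real). complex_of_real
                         ((if d = 1 then ln x + euler_mascheroni else 0) - mangoldt d))"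
  \<comment> \<open>The set \<open>D\<close> carries the induction hypothesis. It is empty for
    \<open>r = 1\<close>, so no separate base case arises.\<close>
  define D where "D = {d. d dvd r \<and> d \<noteq> r}"
  have fin: "finite {d. d dvd r}" using less.prems by simp
  have divs: "{d. d dvd r} = insert r D" "r \<notin> D" "finite D"
    using fin unfolding D_def by auto
  have "(\<lambda>x. \<Sum>d\<in>D. F d x - M d x) \<in> O[principal {1..}](\<lambda>x. 1 / complex_of_real x)"
  proof (rule big_sum_in_bigo)
    fix d assume "d \<in> D"
    hence "d < r" "d > 0"
      using less.prems dvd_imp_le[of d r] dvd_pos_nat[of r d] by (simp_all add: D_def)
    thus "(\<lambda>x. F d x - M d x) \<in> O[principal {1..}](\<lambda>x. 1 / complex_of_real x)"
      unfolding F_def M_def by (rule less.IH)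
  qed
  note diff = sum_in_bigo(2)[OF harm_floor_divide_bigo[OF less.prems] this]
  have sumM: "(\<Sum>d | d dvd r. M d x) = of_real (ln x + euler_mascheroni - ln r)" for x
  proof -
    have "(\<Sum>d | d dvd r. (if d = 1 then ln x + euler_mascheroni else 0)) = ln x + euler_mascheroni"
      using fin by (simp add: sum.delta)
    thus ?thesis
      using mangoldt_sum[of r, where ?'a = real] less.prems
      unfolding M_def of_real_sum [symmetric] sum_subtractf by simp
  qed
  have sumF: "(\<Sum>d | d dvd r. F d x) = of_real (harm (nat \<lfloor>x / r\<rfloor>))" if "x \<ge> 1" for x
  proof -
    have "(\<Sum>d | d dvd r. F d x) =
            (\<Sum>n\<in>{1..nat \<lfloor>x\<rfloor>}. (\<Sum>d | d dvd r. ramanujan_sum d n) / of_nat n)"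
      unfolding F_def sum_divide_distrib by (rule sum.swap)
    thus ?thesis
      using that less.prems by (simp only: sum_ramanujan_sum_divisors sum_multiples_harm)
  qed
  \<comment> \<open>Over all divisors of \<open>r\<close>, the total of the errors
    \<open>F d x - M d x\<close> is the harmonic error; removing those for \<open>d\<close> in
    \<open>D\<close> isolates \<open>r\<close>.\<close>
  have "F r x - M r x = complex_of_real (harm (nat \<lfloor>x / r\<rfloor>) - (ln x + euler_mascheroni - ln r))
          - (\<Sum>d\<in>D. F d x - M d x)" if "x \<ge> 1" for x
    unfolding of_real_diff[of "harm _"] sumF[OF that, symmetric] sumM[symmetric]
    using divs by (simp add: sum_subtractf)
  hence "eventually (\<lambda>x. F r x - M r x =
           complex_of_real (harm (nat \<lfloor>x / r\<rfloor>) - (ln x + euler_mascheroni - ln r))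
             - (\<Sum>d\<in>D. F d x - M d x)) (principal {1..})"
    by (simp add: eventually_principal)
  from landau_o.big.in_cong[OF this] diff show ?case
    unfolding F_def M_def by blast
qed

theorem theorem7p2:
  fixes r :: nat
  assumes "r \<ge> 1"
  shows "\<exists>K::real. \<forall>x::real. x \<ge> 1 \<longrightarrow>
           cmod ((\<Sum>n\<in>{1..nat \<lfloor>x\<rfloor>}. regular_ramanujan_sum r n / of_nat n)
                 - of_real (ln x + euler_mascheroni - unitary_conv mangoldt (\<lambda>_. 1) r))
             \<le> K * x powr (-1)"
proof -
  define U where "U = {d. unitary_divisor d r}"
  have fin: "finite U"
    using assms by (auto simp: U_def unitary_divisor_def intro: finite_subset[OF _ finite_divisors_nat[of r]])
  \<comment> \<open>Since 1 is always a unitary divisor, the term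
    \<open>ln x + euler_mascheroni\<close> enters the sum over \<open>U\<close> exactly
    once.\<close>
  have one: "1 \<in> U" by (simp add: U_def unitary_divisor_def)
  have "(\<lambda>x::real. \<Sum>d\<in>U. (\<Sum>n\<in>{1..nat \<lfloor>x\<rfloor>}. ramanujan_sum d n / of_nat n) -
             of_real ((if d = 1 then ln x + euler_mascheroni else 0) - mangoldt d))
           \<in> O[principal {1..}](\<lambda>x. 1 / complex_of_real x)"
    by (intro big_sum_in_bigo ramanujan_sum_partial_sums) (auto simp: U_def unitary_divisor_def)
  also have "(\<lambda>x::real. \<Sum>d\<in>U. (\<Sum>n\<in>{1..nat \<lfloor>x\<rfloor>}. ramanujan_sum d n / of_nat n) -
               of_real ((if d = 1 then ln x + euler_mascheroni else 0) - mangoldt d)) =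
             (\<lambda>x. (\<Sum>n\<in>{1..nat \<lfloor>x\<rfloor>}. regular_ramanujan_sum r n / of_nat n)
                 - of_real (ln x + euler_mascheroni - unitary_conv mangoldt (\<lambda>_. 1) r))"
  proof
    fix x :: real
    have "(\<Sum>d\<in>U. \<Sum>n\<in>{1..nat \<lfloor>x\<rfloor>}. ramanujan_sum d n / of_nat n) =
          (\<Sum>n\<in>{1..nat \<lfloor>x\<rfloor>}. regular_ramanujan_sum r n / of_nat n)"
      using assms
      by (subst sum.swap) (simp add: regular_ramanujan_sum_conv_ramanujan_sum U_def sum_divide_distrib)
    moreover have "(\<Sum>d\<in>U. (if d = 1 then ln x + euler_mascheroni else 0) - mangoldt d) =
                   ln x + euler_mascheroni - unitary_conv mangoldt (\<lambda>_. 1) r"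
      using fin one by (simp add: sum_subtractf sum.delta unitary_conv_def U_def)
    ultimately show "(\<Sum>d\<in>U. (\<Sum>n\<in>{1..nat \<lfloor>x\<rfloor>}. ramanujan_sum d n / of_nat n) -
               of_real ((if d = 1 then ln x + euler_mascheroni else 0) - mangoldt d)) =
             (\<Sum>n\<in>{1..nat \<lfloor>x\<rfloor>}. regular_ramanujan_sum r n / of_nat n)
                 - of_real (ln x + euler_mascheroni - unitary_conv mangoldt (\<lambda>_. 1) r)"
      by (simp only: sum_subtractf of_real_sum [symmetric])
  qed
  finally obtain K where "\<forall>x\<in>{1..}.
      cmod ((\<Sum>n\<in>{1..nat \<lfloor>x\<rfloor>}. regular_ramanujan_sum r n / of_nat n)
                 - of_real (ln x + euler_mascheroni - unitary_conv mangoldt (\<lambda>_. 1) r))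
        \<le> K * norm (1 / complex_of_real x)"
    by (elim landau_o.bigE) (simp only: eventually_principal)
  thus ?thesis
    by (intro exI[of _ K]) (auto simp: powr_minus_divide norm_divide)
qed

end
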